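(* Let $\mu_0$ be a commutative multiplication on a $\mathbb{K}$-vector space $A$, and let $\mu_t=\mu_0+t\varphi_1+t^2\varphi_2+\cdots$ be a $(Id+c+c^2)$-formal deformation of $\mu_0$. Let $\psi_1(x,y)=\varphi_1(x,y)-\varphi_1(y,x)$. Then $(A[[t]],\mu_t)$ is a deformation quantization of the nonassociative $(Id+c+c^2)$-Poisson algebra $(A,\mu_0,\psi_1)$; that is, $(A,\mu_0,\psi_1)$ is a nonassociative $(Id+c+c^2)$-Poisson algebra.
   Context: $\mathbb{K}$ is a field of characteristic $0$; multiplications are bilinear maps $A\times A\to A$. $\Sigma_3$ is the symmetric group, $c$ is the $3$-cycle with $c(1)=2,\ c(2)=3,\ c(3)=1$. For $v=\sum_\sigma a_\sigma\sigma\in\mathbb{K}[\Sigma_3]$ and a trilinear map $T$ on $A$, $(T\circ\Phi_v)(x_1,x_2,x_3)=\sum_\sigma a_\sigma T(x_{\sigma(1)},x_{\sigma(2)},x_{\sigma(3)})$. For bilinear maps $\varphi,\varphi'$ on $A$ put $(\varphi\bullet\varphi')(x,y,z)=\varphi(\varphi'(x,y),z)-\varphi(x,\varphi'(y,z))$. A $v$-formal deformation of $\mu_0$ is a family of bilinear maps $\varphi_j$ ($j\ge0$) on $A$ with $\varphi_0=\mu_0$, written $\mu_t=\sum_{j\ge 0} t^j\varphi_j$, such that $\sum_{i+j=k}(\varphi_i\bullet\varphi_j)\circ\Phi_v=0$ for all $k\ge0$. For bilinear maps $\mu,\psi$ let $\mathcal{L}(\mu,\psi)(x,y,z)=\psi(x,\mu(y,z))-\mu(y,\psi(x,z))-\mu(\psi(x,y),z)$.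 A nonassociative $v$-Poisson algebra $(A,\mu,\psi)$ is a vector space $A$ with a commutative multiplication $\mu$ and a Lie bracket $\psi$ such that $\mathcal{L}(\mu,\psi)\circ\Phi_v=0$. *)

theory Defs
  imports Complex_Main "HOL-Library.Poly_Mapping" "HOL-Combinatorics.Permutations"
begin

definition bilinear_map ::
    "('k::field \<Rightarrow> 'a::ab_group_add \<Rightarrow> 'a) \<Rightarrow> ('a \<Rightarrow> 'a \<Rightarrow> 'a) \<Rightarrow> bool" where
  "bilinear_map scale f \<longleftrightarrow>
     (\<forall>x. Vector_Spaces.linear scale scale (\<lambda>y. f x y)) \<and>
     (\<forall>y. Vector_Spaces.linear scale scale (\<lambda>x. f x y))"

definition commutative_multiplication ::
    "('k::field \<Rightarrow> 'a::ab_group_add \<Rightarrow> 'a) \<Rightarrow> ('a \<Rightarrow> 'a \<Rightarrow> 'a) \<Rightarrow> bool" where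
  "commutative_multiplication scale \<mu> \<longleftrightarrow> bilinear_map scale \<mu> \<and> (\<forall>x y. \<mu> x y = \<mu> y x)"

definition lie_bracket ::
    "('k::field \<Rightarrow> 'a::ab_group_add \<Rightarrow> 'a) \<Rightarrow> ('a \<Rightarrow> 'a \<Rightarrow> 'a) \<Rightarrow> bool" where
  "lie_bracket scale \<psi> \<longleftrightarrow>
     bilinear_map scale \<psi> \<and>
     (\<forall>x. \<psi> x x = 0) \<and>
     (\<forall>x y z. \<psi> x (\<psi> y z) + \<psi> y (\<psi> z x) + \<psi> z (\<psi> x y) = 0)"

(* Elements of the group algebra K[Sigma_3] are formal linear combinations of
   functions on nat; only the coefficients at permutations of {1, 2, 3} are used. *)
type_synonym 'k group_alg = "(nat \<Rightarrow> nat) \<Rightarrow>\<^sub>0 'k"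

definition cycle3 :: "nat \<Rightarrow> nat" where
  "cycle3 = id(1 := 2, 2 := 3, 3 := 1)"

(* Id + c + c^2 *)
definition cyclic_vector :: "'k::field group_alg" where
  "cyclic_vector =
     Poly_Mapping.single id 1 + Poly_Mapping.single cycle3 1 +
     Poly_Mapping.single (cycle3 \<circ> cycle3) 1"

(* (T o Phi_v)(x1, x2, x3) *)
definition comp_Phi ::
    "('k::field \<Rightarrow> 'a::ab_group_add \<Rightarrow> 'a) \<Rightarrow> ('a \<Rightarrow> 'a \<Rightarrow> 'a \<Rightarrow> 'a) \<Rightarrow> 'k group_alg \<Rightarrow>
     'a \<Rightarrow> 'a \<Rightarrow> 'a \<Rightarrow> 'a" where
  "comp_Phi scale T v x1 x2 x3 =
     (let x = (\<lambda>i::nat. if i = 1 then x1 else if i = 2 then x2 else x3)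
      in \<Sum>\<sigma> | \<sigma> permutes {1, 2, 3}.
           scale (Poly_Mapping.lookup v \<sigma>) (T (x (\<sigma> 1)) (x (\<sigma> 2)) (x (\<sigma> 3))))"

definition bullet ::
    "('a::ab_group_add \<Rightarrow> 'a \<Rightarrow> 'a) \<Rightarrow> ('a \<Rightarrow> 'a \<Rightarrow> 'a) \<Rightarrow> 'a \<Rightarrow> 'a \<Rightarrow> 'a \<Rightarrow> 'a" where
  "bullet \<phi> \<phi>' x y z = \<phi> (\<phi>' x y) z - \<phi> x (\<phi>' y z)"

(* The series mu_t = sum_j t^j phi_j is represented by its coefficient sequence phi. *)
definition formal_deformation ::
    "('k::field \<Rightarrow> 'a::ab_group_add \<Rightarrow> 'a) \<Rightarrow> 'k group_alg \<Rightarrow> ('a \<Rightarrow> 'a \<Rightarrow> 'a) \<Rightarrow>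
     (nat \<Rightarrow> 'a \<Rightarrow> 'a \<Rightarrow> 'a) \<Rightarrow> bool" where
  "formal_deformation scale v \<mu>0 \<phi> \<longleftrightarrow>
     (\<forall>j. bilinear_map scale (\<phi> j)) \<and>
     \<phi> 0 = \<mu>0 \<and>
     (\<forall>k x y z. (\<Sum>i\<le>k. comp_Phi scale (bullet (\<phi> i) (\<phi> (k - i))) v x y z) = 0)"

definition leibniz_defect ::
    "('a::ab_group_add \<Rightarrow> 'a \<Rightarrow> 'a) \<Rightarrow> ('a \<Rightarrow> 'a \<Rightarrow> 'a) \<Rightarrow> 'a \<Rightarrow> 'a \<Rightarrow> 'a \<Rightarrow> 'a" where
  "leibniz_defect \<mu> \<psi> x y z = \<psi> x (\<mu> y z) - \<mu> y (\<psi> x z) - \<mu> (\<psi> x y) z"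

definition nonassoc_poisson ::
    "('k::field \<Rightarrow> 'a::ab_group_add \<Rightarrow> 'a) \<Rightarrow> 'k group_alg \<Rightarrow> ('a \<Rightarrow> 'a \<Rightarrow> 'a) \<Rightarrow>
     ('a \<Rightarrow> 'a \<Rightarrow> 'a) \<Rightarrow> bool" where
  "nonassoc_poisson scale v \<mu> \<psi> \<longleftrightarrow>
     vector_space scale \<and>
     commutative_multiplication scale \<mu> \<and>
     lie_bracket scale \<psi> \<and>
     (\<forall>x y z. comp_Phi scale (leibniz_defect \<mu> \<psi>) v x y z = 0)"

end

theory Submission
  imports Defs
begin

text \<open>Write \<open>S T (x, y, z)\<close> for the cyclic sum of \<open>T\<close>. As \<open>\<mu>0\<close> is commutative,
  \<open>S (\<mu>0 \<bullet> f) = 0\<close> for every \<open>f\<close>, while \<open>S (f \<bullet> \<mu>0) (x, y, z)\<close> is minus the cyclic sum of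
  \<open>[x, \<mu>0 (y, z)]\<^sub>f\<close>, where \<open>[a, b]\<^sub>f = f (a, b) - f (b, a)\<close>. The deformation equation of order 1
  therefore says that the cyclic sum of \<open>\<psi>1 (x, \<mu>0 (y, z))\<close> vanishes; the other terms of the
  Leibniz defect cancel cyclically. In the equation of order 2 the \<open>\<mu>0\<close>-terms are symmetric in
  \<open>x, y, z\<close>, so antisymmetrizing leaves the antisymmetrized associator of \<open>\<phi> 1\<close>, which is the
  Jacobi sum of \<open>\<psi>1\<close> up to sign.\<close>

lemma cycle3_permutes: "cycle3 permutes {1, 2, 3}"
proof (rule bij_imp_permutes)
  show "bij_betw cycle3 {1, 2, 3} {1, 2, 3}"
    by (auto simp: bij_betw_def inj_on_def cycle3_def)
qed (auto simp: cycle3_def)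

text \<open>The support of \<open>cyclic_vector\<close> is the three distinct rotations, each with
  coefficient 1.\<close>

lemma comp_Phi_cyclic_vector:
  fixes scale :: "'k::field \<Rightarrow> 'a::ab_group_add \<Rightarrow> 'a"
  assumes "vector_space scale"
  shows "comp_Phi scale T cyclic_vector x y z = T x y z + T y z x + T z x y"
proof -
  interpret vector_space scale by fact
  have ne: "id \<noteq> cycle3" "id \<noteq> cycle3 \<circ> cycle3" "cycle3 \<noteq> cycle3 \<circ> cycle3"
    by (auto simp: cycle3_def fun_eq_iff)
  have sub: "{id, cycle3, cycle3 \<circ> cycle3} \<subseteq> {\<sigma>. \<sigma> permutes {1, 2, 3}}"
    using cycle3_permutes by (auto intro: permutes_id permutes_compose)
  have lookup: "Poly_Mapping.lookup cyclic_vector \<sigma> =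
      (if \<sigma> \<in> {id, cycle3, cycle3 \<circ> cycle3} then 1 else (0::'k))" for \<sigma>
    using ne by (auto simp: cyclic_vector_def lookup_add lookup_single when_def)
  show ?thesis
    unfolding comp_Phi_def Let_def
    by (subst sum.mono_neutral_right[OF _ sub])
      (use ne in \<open>auto simp: finite_permutations lookup cycle3_def\<close>)
qed

lemma bilinear_map_diff:
  assumes "bilinear_map scale f"
  shows bilinear_map_diff_left: "f (x - x') y = f x y - f x' y"
    and bilinear_map_diff_right: "f x (y - y') = f x y - f x y'"
  using assms module_hom.diff[of scale scale "\<lambda>x. f x y"] module_hom.diff[of scale scale "f x"]
  by (auto simp: bilinear_map_def linear_iff_module_hom)

lemma bilinear_map_commutator:
  assumes "bilinear_map scale f"
  shows "bilinear_map scale (\<lambda>x y. f x y - f y x)"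
proof -
  have hom: "module_hom scale scale (f x)" "module_hom scale scale (\<lambda>x. f x y)" for x y
    using assms by (auto simp: bilinear_map_def linear_iff_module_hom)
  interpret module_pair scale scale
    using hom(1) unfolding module_pair_def module_hom_def by blast
  show ?thesis
    unfolding bilinear_map_def linear_iff_module_hom
    by (auto intro: module_hom_sub hom)
qed

lemma leibniz_defect_cyclic_sum:
  fixes \<mu> \<psi> :: "'a::ab_group_add \<Rightarrow> 'a \<Rightarrow> 'a"
  assumes "bilinear_map scale \<mu>" and comm: "\<And>x y. \<mu> x y = \<mu> y x"
    and skew: "\<And>x y. \<psi> y x = - \<psi> x y"
  shows "leibniz_defect \<mu> \<psi> x y z + leibniz_defect \<mu> \<psi> y z x + leibniz_defect \<mu> \<psi> z x y =
    \<psi> x (\<mu> y z) + \<psi> y (\<mu> z x) + \<psi> z (\<mu> x y)"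
proof -
  \<comment> \<open>Additivity is available for differences: \<open>0 - 0\<close> gives
    \<open>\<mu> a 0 = 0\<close>, then \<open>0 - b\<close> gives the sign rule.\<close>
  have "\<mu> a (- b) = - \<mu> a b" for a b
    using bilinear_map_diff_right[OF assms(1), of a 0 b]
      bilinear_map_diff_right[OF assms(1), of a 0 0] by simp
  then have "\<mu> (\<psi> b a) c = - \<mu> c (\<psi> a b)" for a b c
    using comm skew by metis
  from this[of x y z] this[of y z x] this[of z x y] show ?thesis
    by (simp add: leibniz_defect_def algebra_simps)
qed

text \<open>By commutativity \<open>\<mu> (f x y) z\<close> cancels against
  \<open>\<mu> z (f x y)\<close>, which the rotation (z, x, y) contributes with a minus
  sign.\<close>

lemma bullet_commutative_cyclic_sum:
  fixes \<mu> f :: "'a::ab_group_add \<Rightarrow> 'a \<Rightarrow> 'a"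
  assumes "\<And>x y. \<mu> x y = \<mu> y x"
  shows "bullet \<mu> f x y z + bullet \<mu> f y z x + bullet \<mu> f z x y = 0"
  using assms[of "f x y" z] assms[of "f y z" x] assms[of "f z x" y]
  by (simp add: bullet_def algebra_simps)

text \<open>Both sides expand to the same twelve signed monomials: six orders of the arguments, two
  bracketings each. The odd orders are listed as the rotations of (y, x, z), so that each group is a
  cyclic sum.\<close>

lemma jacobi_commutator:
  fixes f :: "'a::ab_group_add \<Rightarrow> 'a \<Rightarrow> 'a"
  assumes "bilinear_map scale f"
    and \<psi>: "\<And>x y. \<psi> x y = f x y - f y x"
  shows "\<psi> x (\<psi> y z) + \<psi> y (\<psi> z x) + \<psi> z (\<psi> x y) =
    (bullet f f y x z + bullet f f x z y + bullet f f z y x) -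
    (bullet f f x y z + bullet f f y z x + bullet f f z x y)"
  by (simp add: \<psi> bullet_def bilinear_map_diff[OF assms(1)] algebra_simps)

theorem proposition11:
  fixes scale :: "'k::field_char_0 \<Rightarrow> 'a::ab_group_add \<Rightarrow> 'a"
    and \<mu>0 :: "'a \<Rightarrow> 'a \<Rightarrow> 'a"
    and \<phi> :: "nat \<Rightarrow> 'a \<Rightarrow> 'a \<Rightarrow> 'a"
    and \<psi>1 :: "'a \<Rightarrow> 'a \<Rightarrow> 'a"
  assumes "vector_space scale"
    and "commutative_multiplication scale \<mu>0"
    and "formal_deformation scale cyclic_vector \<mu>0 \<phi>"
    and "\<And>x y. \<psi>1 x y = \<phi> 1 x y - \<phi> 1 y x"
  shows "nonassoc_poisson scale cyclic_vector \<mu>0 \<psi>1"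
proof -
  note Phi = comp_Phi_cyclic_vector[OF assms(1)]
  have bil0: "bilinear_map scale \<mu>0" and comm: "\<And>x y. \<mu>0 x y = \<mu>0 y x"
    using assms(2) by (auto simp: commutative_multiplication_def)
  have bil: "bilinear_map scale (\<phi> j)" and \<phi>0: "\<phi> 0 = \<mu>0"
    and eqs: "(\<Sum>i\<le>k. comp_Phi scale (bullet (\<phi> i) (\<phi> (k - i))) cyclic_vector x y z) = 0"
    for j k x y z
    using assms(3) by (auto simp: formal_deformation_def)
  let ?S = "\<lambda>f g x y z. bullet f g x y z + bullet f g y z x + bullet f g z x y"
  have ord1: "?S (\<phi> 1) \<mu>0 x y z = 0" for x y z
    using eqs[of 1 x y z] bullet_commutative_cyclic_sum[of \<mu>0 "\<phi> 1" x y z, OF comm]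
    by (simp add: Phi \<phi>0)
  have ord2: "?S (\<phi> 1) (\<phi> 1) x y z + ?S (\<phi> 2) \<mu>0 x y z = 0" for x y z
    using eqs[of 2 x y z] bullet_commutative_cyclic_sum[of \<mu>0 "\<phi> 2" x y z, OF comm]
    by (simp add: Phi \<phi>0 numeral_2_eq_2)
  \<comment> \<open>Regrouped, the sum runs over the three choices of one argument \<open>c\<close>,
    with terms \<open>f p c - f c p\<close> where \<open>p\<close> is the
    \<open>\<mu>0\<close>-product of the other two; this is unchanged under swaps.\<close>
  have symm: "?S f \<mu>0 y x z = ?S f \<mu>0 x y z" for f x y z
    using comm[of x y] comm[of y z] comm[of x z] by (simp add: bullet_def algebra_simps)
  have "?S (\<phi> 1) (\<phi> 1) y x z = ?S (\<phi> 1) (\<phi> 1) x y z" for x y z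
    using ord2[of x y z] ord2[of y x z] symm[of "\<phi> 2" y x z]
    by (metis add_right_cancel)
  then have jacobi: "\<psi>1 x (\<psi>1 y z) + \<psi>1 y (\<psi>1 z x) + \<psi>1 z (\<psi>1 x y) = 0" for x y z
    unfolding jacobi_commutator[OF bil assms(4)] by simp
  have "\<psi>1 = (\<lambda>x y. \<phi> 1 x y - \<phi> 1 y x)"
    using assms(4) by blast
  then have "lie_bracket scale \<psi>1"
    using bilinear_map_commutator[OF bil] jacobi assms(4) by (simp add: lie_bracket_def)
  moreover have "\<psi>1 x (\<mu>0 y z) + \<psi>1 y (\<mu>0 z x) + \<psi>1 z (\<mu>0 x y) = - ?S (\<phi> 1) \<mu>0 x y z" for x y z
    by (simp add: assms(4) bullet_def algebra_simps)
  then have "comp_Phi scale (leibniz_defect \<mu>0 \<psi>1) cyclic_vector x y z = 0" for x y z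
    unfolding Phi ord1 minus_zero
    by (subst leibniz_defect_cyclic_sum[OF bil0 comm]) (simp_all add: assms(4))
  ultimately show ?thesis
    using assms(1,2) by (simp add: nonassoc_poisson_def)
qed

end
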